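(* Let $A$ and $B$ be finite alphabets and let $f\colon A^*\to B^*$ be a morphism. The following are equivalent: (i) $f$ is Parikh-collinear; (ii) for all integers $k\ge 0$, $f$ satisfies $P_k$; (iii) there exists an integer $k\ge 0$ such that $f$ satisfies $P_k$.
   Context: For a word $u$ and a word $w$, the binomial coefficient $\binom{u}{w}$ is the number of times $w$ occurs as a (scattered) subword of $u$, i.e. writing $u=u_1\cdots u_n$ with letters $u_i$, $\binom{u}{w}=\#\{i_1<\dots<i_{|w|}: u_{i_1}\cdots u_{i_{|w|}}=w\}$. For $k\ge1$, two words $u,v$ are $k$-binomially equivalent, $u\sim_k v$, if $\binom{u}{x}=\binom{v}{x}$ for all words $x$ of length at most $k$; $\sim_0$ is the relation "having equal length". For an infinite word $\mathbf{x}$ and $k\ge 0$, its $k$-binomial complexity is the function $n\mapsto \#(\mathrm{Fac}_n(\mathbf{x})/\sim_k)$, where $\mathrm{Fac}_n(\mathbf{x})$ is the set of length-$n$ factors of $\mathbf{x}$ (the $1$-binomial complexity is the abelian complexity; the $0$-binomial complexity is constantly $1$). The Parikh vector $\Psi(w)$ of $w\in B^*$ is the vector $(|w|_b)_{b\in B}$ of letter counts. A morphism $f\colon A^*\to B^*$ is Parikh-collinear if for all letters $a,b\in A$ there is $r_{a,b}\in\mathbb{Q}$ with $\Psi(f(b))=r_{a,b}\Psi(f(a))$. A morphism $f$ satisfies $P_k$ if $f$ maps all (infinite) words with bounded $k$-binomial complexity to words with bounded $(k+1)$-binomial complexity.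
   Formalization: The morphism f is assumed not to erase every letter (for f identically empty, (i) holds but f(x) is not an infinite word, so P_k is undefined), and P_k is read as requiring that the image f(x) be an infinite word. *)

theory Defs
  imports Complex_Main "HOL-Library.Omega_Words_Fun"
begin

definition word_binomial :: "'a list \<Rightarrow> 'a list \<Rightarrow> nat" where
  "word_binomial u w =
     card {js. sorted_wrt (<) js \<and> set js \<subseteq> {..<length u} \<and> map (\<lambda>j. u ! j) js = w}"

definition binomial_equiv :: "nat \<Rightarrow> 'a list \<Rightarrow> 'a list \<Rightarrow> bool" where
  "binomial_equiv k u v \<longleftrightarrow>
     (if k = 0 then length u = length v
      else (\<forall>x. length x \<le> k \<longrightarrow> word_binomial u x = word_binomial v x))"

definition factors :: "nat \<Rightarrow> 'a word \<Rightarrow> 'a list set" where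
  "factors n x = {x [i \<rightarrow> i + n] | i. True}"

text \<open>The alphabet is a finite type, so the set of factors of length \<open>n\<close> is finite and the
  cardinality of the quotient is its actual number of classes.\<close>

definition binomial_complexity :: "nat \<Rightarrow> ('a::finite) word \<Rightarrow> nat \<Rightarrow> nat" where
  "binomial_complexity k x n = card (factors n x // {(u, v). binomial_equiv k u v})"

definition bounded_binomial_complexity :: "nat \<Rightarrow> ('a::finite) word \<Rightarrow> bool" where
  "bounded_binomial_complexity k x \<longleftrightarrow> (\<exists>C. \<forall>n. binomial_complexity k x n \<le> C)"

definition word_morphism :: "('a list \<Rightarrow> 'b list) \<Rightarrow> bool" where
  "word_morphism f \<longleftrightarrow> f [] = [] \<and> (\<forall>u v. f (u @ v) = f u @ f v)"

definition parikh :: "'a list \<Rightarrow> 'a \<Rightarrow> nat" where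
  "parikh w = (\<lambda>b. count_list w b)"

definition parikh_collinear :: "('a list \<Rightarrow> 'b list) \<Rightarrow> bool" where
  "parikh_collinear f \<longleftrightarrow>
     (\<forall>a b. \<exists>r::rat. \<forall>c. of_nat (parikh (f [b]) c) = r * of_nat (parikh (f [a]) c))"

text \<open>\<open>infinite_image f x y\<close>: the infinite word \<open>y\<close> is \<open>f(x\<^sub>0)f(x\<^sub>1)f(x\<^sub>2)\<dots>\<close>.  Such a
  \<open>y\<close> is unique; it fails to exist exactly when \<open>f\<close> erases all but finitely many
  letters of \<open>x\<close>, so that \<open>f(x)\<close> is a finite word.\<close>

definition infinite_image :: "('a list \<Rightarrow> 'b list) \<Rightarrow> 'a word \<Rightarrow> 'b word \<Rightarrow> bool" where
  "infinite_image f x y \<longleftrightarrow>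
     (\<forall>n. f (prefix n x) = prefix (length (f (prefix n x))) y) \<and>
     (\<forall>m. \<exists>n. m \<le> length (f (prefix n x)))"

text \<open>Binomial complexity is a notion for infinite words, so the image of \<open>x\<close> is required to
  be an infinite word.\<close>

definition satisfies_P :: "nat \<Rightarrow> (('a::finite) list \<Rightarrow> ('b::finite) list) \<Rightarrow> bool" where
  "satisfies_P k f \<longleftrightarrow>
     (\<forall>x. bounded_binomial_complexity k x \<longrightarrow>
        (\<exists>y. infinite_image f x y \<and> bounded_binomial_complexity (k + 1) y))"

end

theory Submission
  imports Defs "HOL-Library.Discrete_Functions" "HOL-Computational_Algebra.Polynomial"
begin

text \<open>
  Suppose \<open>f\<close> is Parikh-collinear and \<open>x\<close> is a word of length \<open>k + 1\<close>. Up to a linear combination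
  of the coefficients of \<open>u\<close> at words of length at most \<open>k\<close>, the coefficient of \<open>f(u)\<close> at \<open>x\<close> is a
  multiple of an elementary symmetric function of the collinearity factors of the letters of \<open>u\<close>,
  which only depends on the Parikh vector of \<open>u\<close>. Hence \<open>f\<close> maps \<open>k\<close>-equivalent words to
  \<open>(k + 1)\<close>-equivalent ones if \<open>k \<ge> 1\<close>. A factor of the image of an infinite word is \<open>s f(w) t\<close> with
  \<open>s\<close>, \<open>t\<close> of bounded length, and bounded abelian complexity confines \<open>|w|\<close> to a window of bounded
  size. If \<open>k = 0\<close>, the Parikh vector of \<open>f(w)\<close> is determined by its length.

  Conversely, let \<open>f(a)\<close> and \<open>f(b)\<close> have non-collinear Parikh vectors and let \<open>\<tau>\<close> be the Thue-Morse
  morphism on \<open>a\<close>, \<open>b\<close>. Being Parikh-collinear, \<open>\<tau>\<close> turns any infinite word \<open>z\<close> into a word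
  \<open>\<tau>\<^sup>k(z)\<close> of bounded \<open>k\<close>-binomial complexity. The words \<open>U = f(\<tau>\<^sup>k(a))\<close> and \<open>V = f(\<tau>\<^sup>k(b))\<close> are
  \<open>k\<close>-equivalent but differ at a word \<open>d c\<^sup>k\<close>, so the coefficient of \<open>U\<^sup>i V\<^sup>n\<^sup>-\<^sup>i\<close> there is affine and
  not constant in \<open>i\<close>. If \<open>z\<close> contains all \<open>a\<^sup>i b\<^sup>j\<close>, then \<open>f(\<tau>\<^sup>k(z))\<close> has unbounded
  \<open>(k + 1)\<close>-binomial complexity. If \<open>k = 0\<close>, suitable powers of \<open>f(a)\<close> and \<open>f(b)\<close> of equal length
  take the roles of \<open>U\<close> and \<open>V\<close>.
\<close>

subsection \<open>Binomial coefficients of words\<close>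

lemma finite_occurrences:
  "finite {js. sorted_wrt (<) js \<and> set js \<subseteq> {..<length u} \<and> map (\<lambda>j. u ! j) js = w}"
  by (rule finite_subset[OF _ finite_lists_length_eq[of "{..<length u}" "length w"]]) auto

lemma word_binomial_Nil [simp]: "word_binomial u [] = 1"
proof -
  have "{js. sorted_wrt (<) js \<and> set js \<subseteq> {..<length u} \<and> map (\<lambda>j. u ! j) js = []} = {[]}"
    by auto
  then show ?thesis
    by (simp add: word_binomial_def)
qed

lemma word_binomial_empty: "w \<noteq> [] \<Longrightarrow> word_binomial [] w = 0"
  by (auto simp: word_binomial_def)

text \<open>Pascal's rule: an occurrence either misses the new position or ends there and leaves an
  occurrence of \<open>w\<close> in \<open>u\<close>.\<close>

lemma word_binomial_snoc:
  "word_binomial (u @ [c]) (w @ [d]) =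
     word_binomial u (w @ [d]) + (if c = d then word_binomial u w else 0)"
proof -
  define occ where "occ u w = {js. sorted_wrt (<) js \<and> set js \<subseteq> {..<length u} \<and> map (\<lambda>j. u ! j) js = w}"
    for u w :: "'a list"
  let ?n = "length u"
  let ?B = "if c = d then (\<lambda>js. js @ [?n]) ` occ u w else {}"
  have nth: "map (\<lambda>j. (u @ [c]) ! j) js = map (\<lambda>j. u ! j) js" if "set js \<subseteq> {..<?n}" for js
    using that by (auto simp: nth_append)
  have "occ (u @ [c]) (w @ [d]) = occ u (w @ [d]) \<union> ?B"
  proof (intro set_eqI iffI)
    fix js assume js: "js \<in> occ (u @ [c]) (w @ [d])"
    then have "js \<noteq> []" by (auto simp: occ_def)
    then obtain ks i where ks: "js = ks @ [i]" by (cases js rule: rev_cases) auto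
    have srt: "sorted_wrt (<) ks" "\<forall>k\<in>set ks. k < i" and i: "i \<le> ?n"
      and m: "map (\<lambda>j. (u @ [c]) ! j) ks = w" "(u @ [c]) ! i = d"
      using js by (auto simp: occ_def ks sorted_wrt_append)
    have sub: "set ks \<subseteq> {..<?n}" using srt i by auto
    show "js \<in> occ u (w @ [d]) \<union> ?B"
    proof (cases "i = ?n")
      case True
      then have "c = d" "ks \<in> occ u w"
        using srt sub m nth[OF sub] by (auto simp: occ_def)
      then show ?thesis using True ks by auto
    next
      case False
      then have "i < ?n" using i by simp
      then have "js \<in> occ u (w @ [d])"
        using srt sub m nth[OF sub] ks by (auto simp: occ_def sorted_wrt_append nth_append)
      then show ?thesis by simp
    qed
  next
    fix js assume "js \<in> occ u (w @ [d]) \<union> ?B"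
    then consider "js \<in> occ u (w @ [d])" | ks where "c = d" "js = ks @ [?n]" "ks \<in> occ u w"
      by (auto split: if_splits)
    then show "js \<in> occ (u @ [c]) (w @ [d])"
    proof cases
      case 1
      then show ?thesis using nth[of js] by (fastforce simp: occ_def)
    next
      case 2
      then show ?thesis using nth[of ks] by (fastforce simp: occ_def sorted_wrt_append)
    qed
  qed
  moreover have "finite (occ u v)" for v
    unfolding occ_def by (rule finite_occurrences)
  moreover have "occ u (w @ [d]) \<inter> ?B = {}"
    by (auto simp: occ_def)
  moreover have "card ?B = (if c = d then card (occ u w) else 0)"
    by (auto intro!: card_image inj_onI)
  ultimately have "card (occ (u @ [c]) (w @ [d])) =
      card (occ u (w @ [d])) + (if c = d then card (occ u w) else 0)"
    by (simp add: card_Un_disjoint)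
  then show ?thesis
    by (simp add: word_binomial_def occ_def)
qed

text \<open>Vandermonde's convolution: an occurrence of \<open>x\<close> reads a prefix of
  \<open>x\<close> inside \<open>u\<close> and the rest inside \<open>v\<close>.\<close>

lemma word_binomial_append:
  "word_binomial (u @ v) x =
     (\<Sum>j\<le>length x. word_binomial u (take j x) * word_binomial v (drop j x))"
proof (induction v arbitrary: x rule: rev_induct)
  case Nil
  have "(\<Sum>j\<le>length x. word_binomial u (take j x) * word_binomial [] (drop j x)) =
      (\<Sum>j\<in>{length x}. word_binomial u (take j x) * word_binomial [] (drop j x))"
    by (rule sum.mono_neutral_right) (auto intro!: word_binomial_empty)
  then show ?case by simp
next
  case (snoc c v)
  show ?case
  proof (cases x rule: rev_cases)
    case Nil
    then show ?thesis by simp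
  next
    case (snoc y d)
    have "word_binomial (u @ v @ [c]) x =
        word_binomial (u @ v) x + (if c = d then word_binomial (u @ v) y else 0)"
      using word_binomial_snoc[of "u @ v" c y d] snoc by simp
    also have "\<dots> = (\<Sum>j\<le>length x. word_binomial u (take j x) * word_binomial v (drop j x)) +
        (\<Sum>j\<le>length y. if c = d then word_binomial u (take j y) * word_binomial v (drop j y) else 0)"
      using snoc.IH by simp
    also have "\<dots> = (\<Sum>j\<le>length y. word_binomial u (take j x) * word_binomial v (drop j x) +
        (if c = d then word_binomial u (take j y) * word_binomial v (drop j y) else 0)) +
        word_binomial u x"
      using snoc by (simp add: sum.distrib)
    also have "(\<Sum>j\<le>length y. word_binomial u (take j x) * word_binomial v (drop j x) +
        (if c = d then word_binomial u (take j y) * word_binomial v (drop j y) else 0)) =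
        (\<Sum>j\<le>length y. word_binomial u (take j x) * word_binomial (v @ [c]) (drop j x))"
      by (rule sum.cong) (auto simp: snoc word_binomial_snoc algebra_simps)
    also have "\<dots> + word_binomial u x =
        (\<Sum>j\<le>length x. word_binomial u (take j x) * word_binomial (v @ [c]) (drop j x))"
      using snoc by simp
    finally show ?thesis .
  qed
qed

lemma word_binomial_singleton [simp]: "word_binomial u [c] = count_list u c"
proof (induction u rule: rev_induct)
  case (snoc d u)
  then show ?case using word_binomial_snoc[of u d "[]" c] by simp
qed (simp add: word_binomial_empty)

lemma word_binomial_replicate: "word_binomial u (replicate m c) = count_list u c choose m"
proof (induction u arbitrary: m rule: rev_induct)
  case Nil
  then show ?case by (cases m) (auto simp: word_binomial_empty)
next
  case (snoc d u)
  show ?case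
  proof (cases m)
    case (Suc l)
    then show ?thesis
      using word_binomial_snoc[of u d "replicate l c" c] snoc.IH[of l] snoc.IH[of m]
      by (auto simp: replicate_append_same)
  qed simp
qed

text \<open>Unlike \<open>binomial_equiv\<close>, this relation is trivial for \<open>k = 0\<close>, which lets the inductions on
  \<open>k\<close> below start at \<open>0\<close> without a hypothesis on lengths.\<close>

definition binomial_agree :: "nat \<Rightarrow> 'a list \<Rightarrow> 'a list \<Rightarrow> bool" where
  "binomial_agree k u v \<longleftrightarrow> (\<forall>x. length x \<le> k \<longrightarrow> word_binomial u x = word_binomial v x)"

lemma binomial_agreeD: "binomial_agree k u v \<Longrightarrow> length x \<le> k \<Longrightarrow> word_binomial u x = word_binomial v x"
  by (simp add: binomial_agree_def)

lemma binomial_agree_refl [simp]: "binomial_agree k u u"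
  by (simp add: binomial_agree_def)

lemma binomial_agree_0 [simp]: "binomial_agree 0 u v"
  by (simp add: binomial_agree_def)

lemma binomial_equiv_iff_agree: "k > 0 \<Longrightarrow> binomial_equiv k u v \<longleftrightarrow> binomial_agree k u v"
  by (simp add: binomial_equiv_def binomial_agree_def)

lemma equiv_binomial_equiv: "equiv UNIV {(u, v). binomial_equiv k u v}"
  by (intro equivI refl_onI symI transI) (auto simp: binomial_equiv_def)

lemma binomial_agree_mset_eq:
  assumes "binomial_agree k u v" "k > 0"
  shows "mset u = mset v"
proof (rule multiset_eqI)
  fix c
  have "word_binomial u [c] = word_binomial v [c]"
    using assms by (intro binomial_agreeD) auto
  then show "count (mset u) c = count (mset v) c"
    by (simp add: count_mset)
qed

lemma binomial_agree_append:
  assumes "binomial_agree k u u'" "binomial_agree k v v'"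
  shows "binomial_agree k (u @ v) (u' @ v')"
  unfolding binomial_agree_def word_binomial_append
  using assms by (auto intro!: sum.cong simp: binomial_agreeD)

text \<open>Every proper split of \<open>x\<close> reads words of length at most \<open>k\<close> on
  both sides and cancels; only the two trivial splits survive.\<close>

lemma word_binomial_append_diff:
  assumes "binomial_agree k u u'" "binomial_agree k v v'" "length x = Suc k"
  shows "int (word_binomial (u @ v) x) - int (word_binomial (u' @ v') x) =
    (int (word_binomial u x) - int (word_binomial u' x)) +
    (int (word_binomial v x) - int (word_binomial v' x))"
proof -
  have split: "word_binomial (s @ t) x = word_binomial s x + word_binomial t x +
      (\<Sum>j<k. word_binomial s (take (Suc j) x) * word_binomial t (drop (Suc j) x))" for s t
  proof -
    let ?g = "\<lambda>j. word_binomial s (take j x) * word_binomial t (drop j x)"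
    have "(\<Sum>j\<le>length x. ?g j) = (\<Sum>j<Suc (Suc k). ?g j)"
      using assms(3) by (simp only: lessThan_Suc_atMost)
    also have "\<dots> = ?g 0 + (\<Sum>j<Suc k. ?g (Suc j))"
      by (rule sum.lessThan_Suc_shift)
    finally show ?thesis
      using assms(3) by (simp add: word_binomial_append[of s t x])
  qed
  have "(\<Sum>j<k. word_binomial u (take (Suc j) x) * word_binomial v (drop (Suc j) x)) =
      (\<Sum>j<k. word_binomial u' (take (Suc j) x) * word_binomial v' (drop (Suc j) x))"
    using assms by (auto intro!: sum.cong arg_cong2[where f="(*)"] simp: binomial_agreeD)
  then show ?thesis
    using split[of u v] split[of u' v'] by simp
qed

subsection \<open>Binomial coefficients of morphic images\<close>

text \<open>The linear span of the coefficients at words shorter than \<open>m\<close>. By the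
  strict bound it is null for \<open>m = 0\<close>, as the remainder for the empty word must
  be.\<close>

inductive_set binomial_span :: "nat \<Rightarrow> ('a list \<Rightarrow> rat) set" for m where
  zero: "(\<lambda>u. 0) \<in> binomial_span m"
| binomial: "length w < m \<Longrightarrow> (\<lambda>u. of_nat (word_binomial u w)) \<in> binomial_span m"
| add: "g \<in> binomial_span m \<Longrightarrow> h \<in> binomial_span m \<Longrightarrow> (\<lambda>u. g u + h u) \<in> binomial_span m"
| scale: "g \<in> binomial_span m \<Longrightarrow> (\<lambda>u. c * g u) \<in> binomial_span m"

lemma binomial_span_mono:
  assumes "g \<in> binomial_span m" "m \<le> n"
  shows "g \<in> binomial_span n"
  using assms by (induction) (auto intro: binomial_span.intros)

lemma binomial_span_sum:
  assumes "\<And>i. i \<in> I \<Longrightarrow> g i \<in> binomial_span m"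
  shows "(\<lambda>u. \<Sum>i\<in>I. g i u) \<in> binomial_span m"
  using assms
  by (induction I rule: infinite_finite_induct) (auto intro: binomial_span.intros)

lemma binomial_span_agree:
  assumes "g \<in> binomial_span (Suc k)" "binomial_agree k u v"
  shows "g u = g v"
  using assms by induction (auto simp: binomial_agreeD)

text \<open>A discrete integral over the prefixes that precede an \<open>a\<close>. It turns the
  coefficient at \<open>w\<close> into the one at \<open>w @ [a]\<close>.\<close>

definition letter_integral :: "'a \<Rightarrow> ('a list \<Rightarrow> rat) \<Rightarrow> 'a list \<Rightarrow> rat" where
  "letter_integral a g u = (\<Sum>i<length u. if u ! i = a then g (take i u) else 0)"

lemma letter_integral_Nil [simp]: "letter_integral a g [] = 0"
  by (simp add: letter_integral_def)

lemma letter_integral_snoc [simp]: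
  "letter_integral a g (u @ [c]) = letter_integral a g u + (if c = a then g u else 0)"
proof -
  have "(\<Sum>i<length u. if (u @ [c]) ! i = a then g (take i (u @ [c])) else 0) =
      (\<Sum>i<length u. if u ! i = a then g (take i u) else 0)"
    by (rule sum.cong) (auto simp: nth_append)
  then show ?thesis by (simp add: letter_integral_def)
qed

lemma letter_integral_add:
  "letter_integral a (\<lambda>u. g u + h u) u = letter_integral a g u + letter_integral a h u"
  by (induction u rule: rev_induct) auto

lemma letter_integral_scale: "letter_integral a (\<lambda>u. c * g u) u = c * letter_integral a g u"
  by (induction u rule: rev_induct) (auto simp: algebra_simps)

lemma letter_integral_binomial:
  "letter_integral a (\<lambda>u. of_nat (word_binomial u w)) u = of_nat (word_binomial u (w @ [a]))"
  by (induction u rule: rev_induct) (auto simp: word_binomial_empty word_binomial_snoc)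

lemma letter_integral_span:
  assumes "g \<in> binomial_span m"
  shows "letter_integral a g \<in> binomial_span (Suc m)"
  using assms
proof induction
  case zero
  have "letter_integral a (\<lambda>u. 0) = (\<lambda>u. 0)"
    by (auto simp: letter_integral_def)
  then show ?case by (simp add: binomial_span.zero)
next
  case (binomial w)
  then show ?case
    using binomial_span.binomial[of "w @ [a]" "Suc m"] by (simp add: letter_integral_binomial)
next
  case (add g h)
  then show ?case
    using binomial_span.add[OF add.IH] by (simp add: letter_integral_add[abs_def])
next
  case (scale g c)
  then show ?case
    using binomial_span.scale[OF scale.IH, of c] by (simp add: letter_integral_scale[abs_def])
qed

text \<open>The elementary symmetric polynomial of degree \<open>m\<close> in the values of
  \<open>r\<close> at the letters of \<open>u\<close>, taken with multiplicity.\<close>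

definition elem_sym :: "('a \<Rightarrow> rat) \<Rightarrow> nat \<Rightarrow> 'a list \<Rightarrow> rat" where
  "elem_sym r m u = coeff (prod_list (map (\<lambda>c. [:1, r c:]) u)) m"

lemma elem_sym_mset_cong:
  assumes "mset u = mset v"
  shows "elem_sym r m u = elem_sym r m v"
proof -
  have "prod_list (map (\<lambda>c. [:1, r c:]) u) = prod_list (map (\<lambda>c. [:1, r c:]) v)"
    using assms by (metis mset_map prod_mset_prod_list)
  then show ?thesis by (simp add: elem_sym_def)
qed

lemma elem_sym_0: "elem_sym r 0 u = 1"
  by (induction u) (auto simp: elem_sym_def)

text \<open>Products of \<open>Suc m\<close> values are sorted by their last position; the other
  \<open>m\<close> values come from the prefix before it.\<close>

lemma elem_sym_Suc:
  fixes r :: "'a::finite \<Rightarrow> rat"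
  shows "elem_sym r (Suc m) u = (\<Sum>a\<in>UNIV. r a * letter_integral a (elem_sym r m) u)"
proof (induction u rule: rev_induct)
  case Nil
  then show ?case by (simp add: elem_sym_def)
next
  case (snoc c u)
  have "elem_sym r (Suc m) (u @ [c]) = elem_sym r (Suc m) u + r c * elem_sym r m u"
    by (simp add: elem_sym_def algebra_simps)
  moreover have "(\<Sum>a\<in>UNIV. r a * letter_integral a (elem_sym r m) (u @ [c])) =
      (\<Sum>a\<in>UNIV. r a * letter_integral a (elem_sym r m) u) +
      (\<Sum>a\<in>UNIV. if c = a then r a * elem_sym r m u else 0)"
    unfolding sum.distrib[symmetric] by (rule sum.cong) (auto simp: algebra_simps)
  ultimately show ?case using snoc.IH by simp
qed

lemma word_morphism_append: "word_morphism f \<Longrightarrow> f (u @ v) = f u @ f v"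
  by (simp add: word_morphism_def)

lemma word_morphism_Nil: "word_morphism f \<Longrightarrow> f [] = []"
  by (simp add: word_morphism_def)

text \<open>Occurrences of a nonempty \<open>x\<close> are sorted by the letter \<open>a\<close> of
  \<open>u\<close> whose image holds their last position: it reads the nonempty
  \<open>drop j x\<close>, the images before it read \<open>take j x\<close>.\<close>

lemma word_binomial_morphism:
  fixes f :: "('a::finite) list \<Rightarrow> 'b list"
  assumes "word_morphism f"
  shows "of_nat (word_binomial (f u) x) = (if x = [] then 1 else 0) +
    (\<Sum>j<length x. \<Sum>a\<in>UNIV. of_nat (word_binomial (f [a]) (drop j x)) *
       letter_integral a (\<lambda>u. of_nat (word_binomial (f u) (take j x))) u)"
proof (induction u rule: rev_induct)
  case Nil
  then show ?case
    using assms by (auto simp: word_binomial_empty word_morphism_Nil)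
next
  case (snoc c u)
  let ?g = "\<lambda>j u. of_nat (word_binomial (f u) (take j x)) :: rat"
  let ?d = "\<lambda>j a. of_nat (word_binomial (f [a]) (drop j x)) :: rat"
  have "of_nat (word_binomial (f (u @ [c])) x) = (\<Sum>j\<le>length x. ?g j u * ?d j c)"
    using assms by (simp add: word_morphism_append word_binomial_append)
  also have "\<dots> = of_nat (word_binomial (f u) x) + (\<Sum>j<length x. ?g j u * ?d j c)"
    by (simp add: lessThan_Suc_atMost[symmetric])
  also have "(\<Sum>j<length x. ?g j u * ?d j c) =
      (\<Sum>j<length x. \<Sum>a\<in>UNIV. if c = a then ?d j a * ?g j u else 0)"
    by (simp add: mult.commute)
  also have "of_nat (word_binomial (f u) x) + \<dots> = (if x = [] then 1 else 0) +
      (\<Sum>j<length x. \<Sum>a\<in>UNIV. ?d j a * letter_integral a (?g j) u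
        + (if c = a then ?d j a * ?g j u else 0))"
    unfolding snoc.IH by (simp add: sum.distrib del: sum.delta sum.delta')
  also have "(\<Sum>j<length x. \<Sum>a\<in>UNIV. ?d j a * letter_integral a (?g j) u
        + (if c = a then ?d j a * ?g j u else 0)) =
      (\<Sum>j<length x. \<Sum>a\<in>UNIV. ?d j a * letter_integral a (?g j) (u @ [c]))"
    by (intro sum.cong) (auto simp: algebra_simps)
  finally show ?case .
qed

text \<open>Strong induction: \<open>take j x\<close> is shorter than \<open>x\<close>, and
  integration raises the degree by only one.\<close>

lemma word_binomial_morphism_span:
  fixes f :: "('a::finite) list \<Rightarrow> 'b list"
  assumes "word_morphism f"
  shows "(\<lambda>u. of_nat (word_binomial (f u) x)) \<in> binomial_span (Suc (length x))"
proof (induction x rule: length_induct)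
  case (1 x)
  have const: "(\<lambda>u. if x = [] then 1 else 0) \<in> binomial_span (Suc (length x))"
    using binomial_span.binomial[of "[]" "Suc (length x)"]
    by (auto intro: binomial_span.zero)
  have "(\<lambda>u. letter_integral a (\<lambda>u. of_nat (word_binomial (f u) (take j x))) u)
      \<in> binomial_span (Suc (length x))" if "j < length x" for j a
  proof -
    have "(\<lambda>u. of_nat (word_binomial (f u) (take j x))) \<in> binomial_span (Suc j)"
      using 1 that by (metis length_take min.absorb4)
    from letter_integral_span[OF this, of a] show ?thesis
      using that by (auto intro: binomial_span_mono)
  qed
  then show ?case
    unfolding word_binomial_morphism[OF assms, of _ x]
    by (intro binomial_span.add const binomial_span_sum binomial_span.scale) auto
qed

text \<open>For a Parikh-collinear morphism the only part of degree \<open>length x\<close> is a multiple of an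
  elementary symmetric function, which depends on the letter counts alone.\<close>

lemma word_binomial_collinear_morphism:
  fixes f :: "('a::finite) list \<Rightarrow> 'b list"
  assumes f: "word_morphism f"
    and r: "\<And>a c. of_nat (count_list (f [a]) c) = r a * p c"
  shows "\<exists>q. \<exists>g \<in> binomial_span (length x).
    \<forall>u. of_nat (word_binomial (f u) x) = q * elem_sym r (length x) u + g u"
proof (induction x rule: rev_induct)
  case Nil
  show ?case
    by (rule exI[of _ 1], rule bexI[of _ "\<lambda>u. 0"]) (auto simp: elem_sym_0 binomial_span.zero)
next
  case (snoc z y)
  then obtain q g where g: "g \<in> binomial_span (length y)"
    and y: "\<And>u. of_nat (word_binomial (f u) y) = q * elem_sym r (length y) u + g u" by blast
  let ?x = "y @ [z]"
  let ?t = "\<lambda>j u. \<Sum>a\<in>UNIV. of_nat (word_binomial (f [a]) (drop j ?x)) *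
       letter_integral a (\<lambda>u. of_nat (word_binomial (f u) (take j ?x))) u"
  \<comment> \<open>Only the split \<open>j = length y\<close> reaches top degree: there
    \<open>f [a]\<close> reads the single letter \<open>z\<close>, with coefficient
    \<open>r a * p z\<close>. The rest goes into \<open>h\<close>.\<close>
  define h where "h u = (\<Sum>j<length y. ?t j u) + p z * (\<Sum>a\<in>UNIV. r a * letter_integral a g u)" for u
  have "(\<lambda>u. letter_integral a (\<lambda>u. of_nat (word_binomial (f u) (take j ?x))) u)
      \<in> binomial_span (length ?x)" if "j < length y" for j a
  proof -
    have "(\<lambda>u. of_nat (word_binomial (f u) (take j ?x))) \<in> binomial_span (Suc j)"
      using word_binomial_morphism_span[OF f, of "take j ?x"] that by simp
    from letter_integral_span[OF this, of a] show ?thesis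
      using that by (auto intro: binomial_span_mono)
  qed
  moreover have "(\<lambda>u. letter_integral a g u) \<in> binomial_span (length ?x)" for a
    using letter_integral_span[OF g] by simp
  ultimately have h: "h \<in> binomial_span (length ?x)"
    unfolding h_def by (intro binomial_span.add binomial_span_sum binomial_span.scale) auto
  have "of_nat (word_binomial (f u) ?x) = p z * q * elem_sym r (length ?x) u + h u" for u
  proof -
    have "of_nat (word_binomial (f u) ?x) = (\<Sum>j<length y. ?t j u) + ?t (length y) u"
      unfolding word_binomial_morphism[OF f, of u ?x] by simp
    also have "?t (length y) u =
        (\<Sum>a\<in>UNIV. p z * q * (r a * letter_integral a (elem_sym r (length y)) u) +
           p z * (r a * letter_integral a g u))"
      by (rule sum.cong) (simp_all add: r y letter_integral_add letter_integral_scale algebra_simps)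
    also have "\<dots> = p z * q * elem_sym r (length ?x) u +
        p z * (\<Sum>a\<in>UNIV. r a * letter_integral a g u)"
      by (simp add: sum.distrib sum_distrib_left elem_sym_Suc)
    finally show ?thesis by (simp add: h_def)
  qed
  then show ?case using h by blast
qed

section \<open>Parikh-collinear morphisms raise the level of agreement\<close>

lemma parikh_collinear_rank_one:
  fixes f :: "'a list \<Rightarrow> 'b list"
  assumes "parikh_collinear f"
  shows "\<exists>(r :: 'a \<Rightarrow> rat) p. \<forall>a c. of_nat (count_list (f [a]) c) = r a * p c"
proof -
  have "\<forall>a. \<exists>r::rat. \<forall>c. of_nat (count_list (f [a]) c) = r * of_nat (count_list (f [undefined]) c)"
    using assms by (simp add: parikh_collinear_def parikh_def)
  then obtain r :: "'a \<Rightarrow> rat" where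
    "\<And>a c. of_nat (count_list (f [a]) c) = r a * of_nat (count_list (f [undefined]) c)"
    by metis
  then show ?thesis
    by (intro exI[of _ r] exI[of _ "\<lambda>c. of_nat (count_list (f [undefined]) c)"] allI)
qed

text \<open>The remainder \<open>g\<close> involves only words of length at most \<open>k\<close>,
  and the symmetric function only letter counts, which agree because \<open>k > 0\<close>.\<close>

lemma collinear_morphism_agree_Suc:
  fixes f :: "('a::finite) list \<Rightarrow> 'b list"
  assumes f: "word_morphism f" and "parikh_collinear f"
    and agree: "binomial_agree k u v" and "k > 0"
  shows "binomial_agree (Suc k) (f u) (f v)"
  unfolding binomial_agree_def
proof (intro allI impI)
  fix x :: "'b list" assume x: "length x \<le> Suc k"
  obtain r :: "'a \<Rightarrow> rat" and p :: "'b \<Rightarrow> rat" where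
    "\<forall>a c. of_nat (count_list (f [a]) c) = r a * p c"
    using parikh_collinear_rank_one[OF assms(2)] by (elim exE)
  then have r: "\<And>a c. of_nat (count_list (f [a]) c) = r a * p c" by simp
  obtain q g where span: "g \<in> binomial_span (length x)"
    and g: "\<And>u. of_nat (word_binomial (f u) x) = q * elem_sym r (length x) u + g u"
    using word_binomial_collinear_morphism[OF f r, of x] by blast
  have "g u = g v"
    by (rule binomial_span_agree[OF binomial_span_mono[OF span x] agree])
  moreover have "elem_sym r (length x) u = elem_sym r (length x) v"
    using binomial_agree_mset_eq[OF agree \<open>k > 0\<close>] by (rule elem_sym_mset_cong)
  ultimately have "(of_nat (word_binomial (f u) x) :: rat) = of_nat (word_binomial (f v) x)"
    by (simp add: g)
  then show "word_binomial (f u) x = word_binomial (f v) x" by simp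
qed

subsection \<open>Factors of infinite images\<close>

text \<open>Covering words need not be factors, so they can be mapped by morphisms and multiplied by
  border words.\<close>

lemma bounded_binomial_complexity_iff_cover:
  fixes x :: "('a::finite) word"
  shows "bounded_binomial_complexity k x \<longleftrightarrow>
    (\<exists>C. \<forall>n. \<exists>T. finite T \<and> card T \<le> C \<and> (\<forall>u\<in>factors n x. \<exists>t\<in>T. binomial_equiv k u t))"
proof -
  let ?R = "{(u, v). binomial_equiv k u v} :: ('a list \<times> 'a list) set"
  have "card (factors n x // ?R) \<le> C \<longleftrightarrow>
      (\<exists>T. finite T \<and> card T \<le> C \<and> (\<forall>u\<in>factors n x. \<exists>t\<in>T. binomial_equiv k u t))" for n C
  proof
    assume C: "card (factors n x // ?R) \<le> C"
    have "finite {u :: 'a list. set u \<subseteq> UNIV \<and> length u = n}"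
      by (rule finite_lists_length_eq) simp
    then have "finite (factors n x)"
      by (rule rev_finite_subset) (auto simp: factors_def)
    then have fin: "finite (factors n x // ?R)"
      by (simp add: quotient_def)
    let ?T = "(\<lambda>X. SOME v. v \<in> X) ` (factors n x // ?R)"
    have "\<exists>t\<in>?T. binomial_equiv k u t" if "u \<in> factors n x" for u
    proof
      have "u \<in> ?R `` {u}" by (auto simp: binomial_equiv_def)
      then have "(SOME v. v \<in> ?R `` {u}) \<in> ?R `` {u}" by (rule someI)
      then show "binomial_equiv k u (SOME v. v \<in> ?R `` {u})" by simp
      show "(SOME v. v \<in> ?R `` {u}) \<in> ?T"
        using that by (intro imageI quotientI)
    qed
    moreover have "card ?T \<le> C"
      using card_image_le[OF fin] C by (rule order_trans)
    ultimately show "\<exists>T. finite T \<and> card T \<le> C \<and> (\<forall>u\<in>factors n x. \<exists>t\<in>T. binomial_equiv k u t)"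
      using fin by blast
  next
    assume "\<exists>T. finite T \<and> card T \<le> C \<and> (\<forall>u\<in>factors n x. \<exists>t\<in>T. binomial_equiv k u t)"
    then obtain T where T: "finite T" "card T \<le> C"
      "\<And>u. u \<in> factors n x \<Longrightarrow> \<exists>t\<in>T. binomial_equiv k u t" by blast
    have "factors n x // ?R \<subseteq> (\<lambda>t. ?R `` {t}) ` T"
    proof
      fix X assume "X \<in> factors n x // ?R"
      then obtain u where u: "u \<in> factors n x" "X = ?R `` {u}" by (auto elim: quotientE)
      then obtain t where "t \<in> T" "binomial_equiv k u t" using T by blast
      then have "X = ?R `` {t}"
        using u equiv_class_eq[OF equiv_binomial_equiv, of u t k] by simp
      then show "X \<in> (\<lambda>t. ?R `` {t}) ` T" using \<open>t \<in> T\<close> by simp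
    qed
    then show "card (factors n x // ?R) \<le> C"
      using T card_image_le[OF T(1), of "\<lambda>t. ?R `` {t}"] card_mono[OF finite_imageI[OF T(1)]]
      by (meson order_trans)
  qed
  then show ?thesis
    by (simp add: bounded_binomial_complexity_def binomial_complexity_def)
qed

lemma subsequence_join: "i \<le> j \<Longrightarrow> j \<le> k \<Longrightarrow> x [i \<rightarrow> j] @ x [j \<rightarrow> k] = x [i \<rightarrow> k]"
  using upt_add_eq_append[of i j "k - j"]
  by (simp add: subsequence_def flip: map_append)

lemma morphism_length_mset_cong:
  assumes "word_morphism f" "mset u = mset v"
  shows "length (f u) = length (f v)"
proof -
  have "length (f w) = sum_list (map (\<lambda>a. length (f [a])) w)" for w
    using assms(1) by (induction w rule: rev_induct) (auto simp: word_morphism_Nil word_morphism_append)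
  then show ?thesis
    using assms(2) by (metis mset_map sum_mset_sum_list)
qed

lemma nonerasing_length_le:
  assumes "word_morphism f" "\<And>a. f [a] \<noteq> []"
  shows "length u \<le> length (f u)"
proof (induction u rule: rev_induct)
  case (snoc a u)
  have "length (f [a]) \<ge> 1" using assms(2) by (simp add: Suc_le_eq)
  then show ?case using snoc assms(1) by (simp add: word_morphism_append)
qed simp

lemma infinite_image_subsequence:
  assumes "word_morphism f" "infinite_image f x y" "i \<le> j"
  shows "y [length (f (prefix i x)) \<rightarrow> length (f (prefix j x))] = f (x [i \<rightarrow> j])"
proof -
  have "f (prefix j x) = f (prefix i x) @ f (x [i \<rightarrow> j])"
    using assms(3) by (simp add: subsequence_join flip: word_morphism_append[OF assms(1)])
  then have "f (x [i \<rightarrow> j]) = drop (length (f (prefix i x))) (f (prefix j x))" by simp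
  also have "f (prefix j x) = prefix (length (f (prefix j x))) y"
    using assms by (simp add: infinite_image_def)
  also have "drop (length (f (prefix i x))) (prefix (length (f (prefix j x))) y) =
      y [length (f (prefix i x)) \<rightarrow> length (f (prefix j x))]"
    by (subst subsequence_drop) simp
  finally show ?thesis by simp
qed

lemma infinite_image_exists:
  assumes f: "word_morphism f" and ne: "\<And>a. f [a] \<noteq> []"
  shows "\<exists>y. infinite_image f x y"
proof -
  \<comment> \<open>No letter is erased, so the image of the first \<open>Suc m\<close> letters has
    an index \<open>m\<close>.\<close>
  define y where "y m = f (prefix (Suc m) x) ! m" for m
  have len: "n \<le> length (f (prefix n x))" for n
    using nonerasing_length_le[OF f ne, of "prefix n x"] by simp
  have ext: "f (prefix n' x) ! m = f (prefix n x) ! m"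
    if "n \<le> n'" "m < length (f (prefix n x))" for n n' m
  proof -
    have "f (prefix n' x) = f (prefix n x) @ f (x [n \<rightarrow> n'])"
      using that(1) by (simp add: subsequence_join flip: word_morphism_append[OF f])
    then show ?thesis using that(2) by (simp add: nth_append)
  qed
  have "f (prefix n x) = prefix (length (f (prefix n x))) y" for n
  proof (rule nth_equalityI)
    fix m assume m: "m < length (f (prefix n x))"
    have "f (prefix (Suc m) x) ! m = f (prefix n x) ! m"
      using ext[of n "Suc m" m] ext[of "Suc m" n m] len[of "Suc m"] m
      by (cases "n \<le> Suc m") (auto simp del: subseq_to_Suc)
    then show "f (prefix n x) ! m = prefix (length (f (prefix n x))) y ! m"
      using m by (simp add: y_def del: subseq_to_Suc)
  qed simp
  then show ?thesis
    using len by (auto simp: infinite_image_def)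
qed

text \<open>The factor is cut at the first image boundary not before its start and at the last one
  not beyond its end. If the former lies beyond the end, the factor is short.\<close>

lemma factor_of_infinite_image:
  assumes f: "word_morphism f" and y: "infinite_image f x y"
    and L: "\<And>a. length (f [a]) \<le> L" and u: "u \<in> factors n y"
  shows "length u \<le> L \<or>
    (\<exists>s t m. \<exists>w \<in> factors m x. u = s @ f w @ t \<and> length s \<le> L \<and> length t \<le> L)"
proof -
  obtain q where q: "u = y [q \<rightarrow> q + n]" using u by (auto simp: factors_def)
  define P where "P i = length (f (prefix i x))" for i
  have P0: "P 0 = 0" using f by (simp add: P_def word_morphism_Nil)
  have PS: "P (Suc i) = P i + length (f [x i])" for i
    using f by (simp add: P_def word_morphism_append)
  have "mono P" by (simp add: mono_iff_le_Suc PS)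
  have unb: "\<exists>i. q' \<le> P i" for q'
    using y by (simp add: infinite_image_def P_def)
  define i where "i = (LEAST i. q \<le> P i)"
  have i: "q \<le> P i" using unb[of q] unfolding i_def by (rule LeastI_ex)
  have iL: "P i \<le> q + L"
  proof (cases i)
    case (Suc i')
    then have "P i' < q" using not_less_Least[of i' "\<lambda>i. q \<le> P i"] by (simp add: i_def)
    then show ?thesis using PS[of i'] L[of "x i'"] Suc by simp
  qed (simp add: P0)
  show ?thesis
  proof (cases "P i \<le> q + n")
    case False
    then show ?thesis using iL q by simp
  next
    case True
    \<comment> \<open>The first boundary strictly beyond the end; its predecessor \<open>j'\<close>
      is the last usable one.\<close>
    define j where "j = (LEAST j. q + n < P j)"
    have "\<exists>j. q + n < P j" using unb[of "Suc (q + n)"] by (simp add: Suc_le_eq)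
    then have j: "q + n < P j" unfolding j_def by (rule LeastI_ex)
    then have "i < j" using True monoD[OF \<open>mono P\<close>, of j i] by linarith
    then obtain j' where j': "j = Suc j'" "i \<le> j'" by (cases j) auto
    have Pj': "P j' \<le> q + n"
      using not_less_Least[of j' "\<lambda>j. q + n < P j"] j' by (simp add: j_def)
    have "length (y [P j' \<rightarrow> q + n]) \<le> L"
      using j PS[of j'] L[of "x j'"] j' by simp
    moreover have "length (y [q \<rightarrow> P i]) \<le> L" using iL by simp
    moreover have "u = y [q \<rightarrow> P i] @ f (x [i \<rightarrow> j']) @ y [P j' \<rightarrow> q + n]"
    proof -
      have "P i \<le> P j'" using \<open>mono P\<close> j' by (simp add: monoD)
      then have "u = y [q \<rightarrow> P i] @ y [P i \<rightarrow> P j'] @ y [P j' \<rightarrow> q + n]"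
        using q i True Pj' by (simp add: subsequence_join)
      then show ?thesis
        using infinite_image_subsequence[OF f y j'(2)] by (simp add: P_def)
    qed
    moreover have "x [i \<rightarrow> j'] \<in> factors (j' - i) x"
      using j' by (auto simp: factors_def intro!: exI[of _ i])
    ultimately show ?thesis by blast
  qed
qed

section \<open>Integer sequences with bounded steps\<close>

lemma discrete_ivt:
  fixes g :: "nat \<Rightarrow> nat"
  assumes step: "\<And>s. g (Suc s) \<le> g s + L" and "g i \<le> v" "v \<le> g j" "i \<le> j"
  shows "\<exists>s. v \<le> g s \<and> g s \<le> v + L"
proof -
  \<comment> \<open>Unless this first index is \<open>i\<close>, its predecessor lies below
    \<open>v\<close>, so the step overshoots by at most \<open>L\<close>.\<close>
  define s where "s = (LEAST s. i \<le> s \<and> v \<le> g s)"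
  have s: "i \<le> s \<and> v \<le> g s"
    unfolding s_def by (rule LeastI[of _ j]) (use assms in auto)
  have "g s \<le> v + L"
  proof (cases "s = i")
    case False
    then obtain s' where s': "s = Suc s'" "i \<le> s'" using s by (cases s) auto
    then have "g s' < v" using not_less_Least[of s' "\<lambda>s. i \<le> s \<and> v \<le> g s"] by (simp add: s_def)
    then show ?thesis using step[of s'] s' by simp
  qed (use assms in simp)
  then show ?thesis using s by blast
qed

text \<open>If \<open>g j\<close> were larger, \<open>card V + 1\<close> disjoint windows of
  \<open>L + 1\<close> consecutive integers would start between \<open>g i\<close> and
  \<open>g j\<close>. The sequence cannot jump over any of them and would take too many
  values.\<close>

lemma slowly_varying_finite_range:
  fixes g :: "nat \<Rightarrow> nat"
  assumes up: "\<And>s. g (Suc s) \<le> g s + L" and down: "\<And>s. g s \<le> g (Suc s) + L"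
    and fin: "finite V" and V: "range g \<subseteq> V"
  shows "g j \<le> g i + Suc L * card V"
proof (rule ccontr)
  assume far: "\<not> ?thesis"
  have near: "\<exists>s. v \<le> g s \<and> g s \<le> v + L" if "g i \<le> v" "v \<le> g j" for v
  proof (cases "i \<le> j")
    case True
    then show ?thesis using discrete_ivt[of g L i v j] up that by blast
  next
    case False
    \<comment> \<open>The sequence is read backwards from \<open>i\<close>; truncated subtraction
      keeps it constant once index 0 is reached.\<close>
    have "g (i - Suc s) \<le> g (i - s) + L" for s
      using down[of "i - Suc s"] by (cases "s < i") (auto simp: Suc_diff_Suc)
    from discrete_ivt[of "\<lambda>s. g (i - s)" L 0 v "i - j", OF this] show ?thesis
      using that False by auto
  qed
  have "\<exists>w\<in>V. g i + Suc L * t \<le> w \<and> w \<le> g i + Suc L * t + L" if "t \<le> card V" for t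
  proof -
    have "Suc L * t \<le> Suc L * card V" using that by (rule mult_le_mono2)
    then have "g i + Suc L * t \<le> g j" using far by linarith
    with near[OF le_add1] obtain s where "g i + Suc L * t \<le> g s" "g s \<le> g i + Suc L * t + L" by blast
    then show ?thesis using V by blast
  qed
  then obtain w where w: "\<And>t. t \<le> card V \<Longrightarrow> w t \<in> V"
    "\<And>t. t \<le> card V \<Longrightarrow> g i + Suc L * t \<le> w t \<and> w t \<le> g i + Suc L * t + L"
    by metis
  have less: "w s < w t" if "s < t" "t \<le> card V" for s t
  proof -
    have "Suc L * Suc s \<le> Suc L * t" using that by (intro mult_le_mono2) simp
    moreover have "Suc L * Suc s = Suc L * s + Suc L" by simp
    ultimately show ?thesis using w(2)[of s] w(2)[of t] that by linarith
  qed
  have "inj_on w {..card V}"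
    using less by (intro linorder_inj_onI) (auto dest: less_imp_neq)
  moreover have "w ` {..card V} \<subseteq> V" using w(1) by auto
  ultimately have "card {..card V} \<le> card V" using fin by (rule card_inj_on_le)
  then show False by simp
qed

text \<open>The Parikh vector of \<open>f w\<close> is a scalar times \<open>p\<close>, and the
  length is that scalar times the total of \<open>p\<close>. The total is nonzero as nothing is
  erased, so the length fixes the scalar.\<close>

lemma collinear_morphism_agree_1:
  fixes f :: "('a::finite) list \<Rightarrow> ('b::finite) list"
  assumes f: "word_morphism f" and "parikh_collinear f" and ne: "\<And>a. f [a] \<noteq> []"
    and len: "length (f u) = length (f v)"
  shows "binomial_agree (Suc 0) (f u) (f v)"
proof -
  obtain r :: "'a \<Rightarrow> rat" and p :: "'b \<Rightarrow> rat" where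
    "\<forall>a c. of_nat (count_list (f [a]) c) = r a * p c"
    using parikh_collinear_rank_one[OF assms(2)] by (elim exE)
  then have r: "\<And>a c. of_nat (count_list (f [a]) c) = r a * p c" by simp
  have count: "of_nat (count_list (f w) c) = sum_list (map r w) * p c" for w c
    using f by (induction w rule: rev_induct)
      (simp_all add: word_morphism_Nil word_morphism_append r algebra_simps)
  have "of_nat (length (f w)) = (\<Sum>c\<in>UNIV. of_nat (count_list (f w) c) :: rat)" for w
    using sum_count_set[of "f w" UNIV] by (simp flip: of_nat_sum)
  then have length: "of_nat (length (f w)) = sum_list (map r w) * (\<Sum>c\<in>UNIV. p c)" for w
    by (simp add: count sum_distrib_left)
  have "(\<Sum>c\<in>UNIV. p c) \<noteq> 0"
    using length[of "[undefined]"] ne[of undefined] by auto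
  then have "sum_list (map r u) = sum_list (map r v)"
    using length[of u] length[of v] len by simp
  then have "(of_nat (count_list (f u) c) :: rat) = of_nat (count_list (f v) c)" for c
    by (simp add: count)
  then have "count_list (f u) c = count_list (f v) c" for c
    by simp
  then show ?thesis
    unfolding binomial_agree_def by (auto simp: le_Suc_eq length_Suc_conv)
qed

text \<open>Shifting the window by one letter changes the image length by at most \<open>L\<close>,
  and at most \<open>card T\<close> lengths occur, since equivalent words with \<open>k > 0\<close>
  have images of equal length.\<close>

lemma morphism_length_balanced:
  fixes f :: "('a::finite) list \<Rightarrow> 'b list"
  assumes f: "word_morphism f" and L: "\<And>a. length (f [a]) \<le> L" and "k > 0"
    and T: "finite T" "\<And>u. u \<in> factors m x \<Longrightarrow> \<exists>t\<in>T. binomial_equiv k u t"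
    and u: "u \<in> factors m x" and v: "v \<in> factors m x"
  shows "length (f v) \<le> length (f u) + Suc L * card T"
proof -
  define g where "g i = length (f (x [i \<rightarrow> i + m]))" for i
  let ?V = "(\<lambda>t. length (f t)) ` T"
  have shift: "g (Suc i) + length (f [x i]) = g i + length (f [x (i + m)])" for i
  proof -
    have "[x i] @ x [Suc i \<rightarrow> Suc i + m] = x [i \<rightarrow> i + m] @ [x (i + m)]"
      using subsequence_join[of i "Suc i" "Suc i + m" x] by simp
    from arg_cong[OF this, of "\<lambda>w. length (f w)"] show ?thesis
      by (simp add: word_morphism_append[OF f] g_def del: append.simps subseq_to_Suc)
  qed
  have "range g \<subseteq> ?V"
  proof safe
    fix i
    have "x [i \<rightarrow> i + m] \<in> factors m x" by (auto simp: factors_def)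
    then obtain t where "t \<in> T" and t: "binomial_equiv k (x [i \<rightarrow> i + m]) t" using T by blast
    have "mset (x [i \<rightarrow> i + m]) = mset t"
      using t \<open>k > 0\<close> by (intro binomial_agree_mset_eq) (simp_all add: binomial_equiv_iff_agree)
    then have "g i = length (f t)"
      unfolding g_def by (rule morphism_length_mset_cong[OF f])
    then show "g i \<in> ?V" using \<open>t \<in> T\<close> by simp
  qed
  moreover have "g (Suc i) \<le> g i + L" "g i \<le> g (Suc i) + L" for i
    using shift[of i] L[of "x i"] L[of "x (i + m)"] by linarith+
  ultimately have le: "g j \<le> g i + Suc L * card ?V" for i j
    using T(1) by (intro slowly_varying_finite_range) auto
  have "Suc L * card ?V \<le> Suc L * card T"
    using T(1) by (intro mult_le_mono2 card_image_le)
  moreover obtain i j where "u = x [i \<rightarrow> i + m]" "v = x [j \<rightarrow> j + m]"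
    using u v by (auto simp: factors_def)
  ultimately show ?thesis
    using le[of j i] by (simp add: g_def)
qed

section \<open>Bounded complexity of collinear images\<close>

lemma factors_append:
  assumes "w \<in> factors (m + d) x"
  obtains u v where "w = u @ v" "u \<in> factors m x" "length v = d"
proof -
  obtain i where i: "w = x [i \<rightarrow> i + (m + d)]" using assms by (auto simp: factors_def)
  show ?thesis
  proof
    show "w = x [i \<rightarrow> i + m] @ x [i + m \<rightarrow> i + (m + d)]"
      using i by (simp add: subsequence_join)
  qed (auto simp: factors_def)
qed

lemma factors_length: "u \<in> factors m x \<Longrightarrow> length u = m"
  by (auto simp: factors_def)

text \<open>Meant for the cores \<open>f w\<close> of factors of length \<open>n\<close> of the
  image: removing two borders of length at most \<open>L\<close> leaves between
  \<open>n - 2 * L\<close> and \<open>n\<close> letters.\<close>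

lemma collinear_morphism_cover:
  fixes f :: "('a::finite) list \<Rightarrow> ('b::finite) list"
  assumes f: "word_morphism f" and col: "parikh_collinear f" and ne: "\<And>a. f [a] \<noteq> []"
    and L: "\<And>a. length (f [a]) \<le> L" and x: "bounded_binomial_complexity k x"
  shows "\<exists>C. \<forall>n. \<exists>T. finite T \<and> card T \<le> C \<and>
    (\<forall>m. \<forall>w\<in>factors m x. n \<le> length (f w) + 2 * L \<and> length (f w) \<le> n \<longrightarrow>
       (\<exists>t\<in>T. binomial_agree (Suc k) (f w) t))"
proof (cases "k = 0")
  case True
  show ?thesis
  proof (intro exI[of _ "Suc (2 * L)"] allI)
    fix n
    \<comment> \<open>If no image has length \<open>l\<close> the choice is arbitrary; the agreement
      below concerns only lengths that occur.\<close>
    define rep where "rep l = f (SOME w. length (f w) = l)" for l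
    have rep: "binomial_agree (Suc 0) (f w) (rep (length (f w)))" for w
      unfolding rep_def
      by (rule collinear_morphism_agree_1[OF f col ne])
        (metis (mono_tags, lifting) someI_ex)
    let ?T = "rep ` {n - 2 * L..n}"
    have "card ?T \<le> card {n - 2 * L..n}" by (rule card_image_le) simp
    then have "card ?T \<le> Suc (2 * L)" by simp
    moreover have "\<exists>t\<in>?T. binomial_agree (Suc k) (f w) t"
      if "n \<le> length (f w) + 2 * L" "length (f w) \<le> n" for w
      using that rep[of w] True by (intro bexI[of _ "rep (length (f w))"]) auto
    ultimately show "\<exists>T. finite T \<and> card T \<le> Suc (2 * L) \<and>
        (\<forall>m. \<forall>w\<in>factors m x. n \<le> length (f w) + 2 * L \<and> length (f w) \<le> n \<longrightarrow>
           (\<exists>t\<in>T. binomial_agree (Suc k) (f w) t))"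
      by (intro exI[of _ ?T]) simp
  qed
next
  case False
  then have k: "k > 0" by simp
  obtain C where "\<forall>m. \<exists>T. finite T \<and> card T \<le> C \<and> (\<forall>u\<in>factors m x. \<exists>t\<in>T. binomial_equiv k u t)"
    using x by (auto simp: bounded_binomial_complexity_iff_cover)
  then obtain T where T: "\<And>m. finite (T m)" "\<And>m. card (T m) \<le> C"
    "\<And>m u. u \<in> factors m x \<Longrightarrow> \<exists>t\<in>T m. binomial_equiv k u t"
    by metis
  \<comment> \<open>When a \<open>w\<close> in the window extends a factor of the least length
    \<open>m0\<close> by \<open>v\<close>, the image of \<open>v\<close> is at most the window width
    \<open>2 * L\<close> plus the imbalance \<open>Suc L * C\<close> long. This also bounds
    \<open>v\<close>.\<close>
  define D where "D = 2 * L + Suc L * C"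
  show ?thesis
  proof (intro exI[of _ "Suc D * C"] allI)
    fix n
    define W where "W m w \<longleftrightarrow> w \<in> factors m x \<and> n \<le> length (f w) + 2 * L \<and> length (f w) \<le> n" for m w
    define m0 where "m0 = (LEAST m. \<exists>w. W m w)"
    have window: "m \<in> {m0..m0 + D}" if w: "W m w" for m w
    proof -
      have "m0 \<le> m" unfolding m0_def using w by (intro Least_le) blast
      have "\<exists>w. W m0 w" unfolding m0_def by (rule LeastI_ex) (use w in blast)
      then obtain w0 where w0: "W m0 w0" by blast
      obtain d where d: "m = m0 + d" using \<open>m0 \<le> m\<close> le_Suc_ex by blast
      obtain u v where uv: "w = u @ v" "u \<in> factors m0 x" "length v = d"
        using w d factors_append[of w m0 d x] by (auto simp: W_def)
      have "length (f w0) \<le> length (f u) + Suc L * card (T m0)"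
        using w0 uv(2) by (intro morphism_length_balanced[OF f L k T(1) T(3)]) (auto simp: W_def)
      also have "\<dots> \<le> length (f u) + Suc L * C"
        using T(2) by (intro add_left_mono mult_le_mono2)
      finally have "length (f v) \<le> D"
        using w w0 uv(1) by (simp add: W_def D_def word_morphism_append[OF f])
      then have "d \<le> D"
        using nonerasing_length_le[OF f ne, of v] uv(3) by simp
      then show ?thesis using d by simp
    qed
    let ?S = "\<Union>m\<in>{m0..m0 + D}. f ` T m"
    have "card ?S \<le> (\<Sum>m\<in>{m0..m0 + D}. card (f ` T m))"
      by (rule card_UN_le) simp
    also have "\<dots> \<le> (\<Sum>m\<in>{m0..m0 + D}. C)"
      using T(1,2) by (intro sum_mono) (meson card_image_le order_trans)
    finally have "card ?S \<le> Suc D * C" by simp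
    moreover have "\<exists>t\<in>?S. binomial_agree (Suc k) (f w) t" if w: "W m w" for m w
    proof -
      obtain t where t: "t \<in> T m" "binomial_equiv k w t" using w T(3) by (auto simp: W_def)
      then have "binomial_agree (Suc k) (f w) (f t)"
        using k by (intro collinear_morphism_agree_Suc[OF f col]) (auto simp: binomial_equiv_iff_agree)
      then show ?thesis using t window[OF w] by blast
    qed
    moreover have "finite ?S" using T(1) by simp
    ultimately show "\<exists>T. finite T \<and> card T \<le> Suc D * C \<and>
        (\<forall>m. \<forall>w\<in>factors m x. n \<le> length (f w) + 2 * L \<and> length (f w) \<le> n \<longrightarrow>
           (\<exists>t\<in>T. binomial_agree (Suc k) (f w) t))"
      unfolding W_def by (intro exI[of _ ?S]) blast
  qed
qed

lemma parikh_collinear_imp_satisfies_P: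
  fixes f :: "('a::finite) list \<Rightarrow> ('b::finite) list"
  assumes f: "word_morphism f" and col: "parikh_collinear f" and ne: "\<And>a. f [a] \<noteq> []"
  shows "satisfies_P k f"
  unfolding satisfies_P_def
proof (intro allI impI)
  fix x :: "'a word" assume x: "bounded_binomial_complexity k x"
  obtain y where y: "infinite_image f x y"
    using infinite_image_exists[OF f ne] by blast
  define L where "L = Max (range (\<lambda>a. length (f [a])))"
  have L: "length (f [a]) \<le> L" for a
    unfolding L_def by (rule Max_ge) auto
  obtain C where C: "\<And>n. \<exists>T. finite T \<and> card T \<le> C \<and>
    (\<forall>m. \<forall>w\<in>factors m x. n \<le> length (f w) + 2 * L \<and> length (f w) \<le> n \<longrightarrow>
       (\<exists>t\<in>T. binomial_agree (Suc k) (f w) t))"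
    using collinear_morphism_cover[OF f col ne L x] by blast
  define S where "S = {s :: 'b list. length s \<le> L}"
  have S: "finite S"
    using finite_lists_length_le[of "UNIV :: 'b set" L] by (simp add: S_def)
  \<comment> \<open>Representatives are the short words themselves and all products of a border, a
    core representative and a border.\<close>
  have "\<exists>T. finite T \<and> card T \<le> card S + card S * (C * card S) \<and>
      (\<forall>u\<in>factors n y. \<exists>t\<in>T. binomial_equiv (k + 1) u t)" for n
  proof -
    obtain T where T: "finite T" "card T \<le> C"
      "\<And>m w. w \<in> factors m x \<Longrightarrow> n \<le> length (f w) + 2 * L \<Longrightarrow> length (f w) \<le> n \<Longrightarrow>
         \<exists>t\<in>T. binomial_agree (Suc k) (f w) t"
      using C[of n] by blast
    let ?F = "(\<lambda>(s, v, t). s @ v @ t) ` (S \<times> T \<times> S)"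
    have "card ?F \<le> card (S \<times> T \<times> S)"
      using S T(1) by (intro card_image_le) auto
    also have "\<dots> \<le> card S * (C * card S)"
      using T(2) by (simp add: card_cartesian_product)
    finally have "card (S \<union> ?F) \<le> card S + card S * (C * card S)"
      using card_Un_le[of S ?F] by linarith
    moreover have "\<exists>t\<in>S \<union> ?F. binomial_equiv (k + 1) u t" if u: "u \<in> factors n y" for u
      using factor_of_infinite_image[OF f y L u]
    proof (elim disjE exE bexE conjE)
      assume "length u \<le> L"
      then show ?thesis
        by (intro bexI[of _ u]) (auto simp: S_def binomial_equiv_iff_agree)
    next
      fix s t m w
      assume w: "w \<in> factors m x" "u = s @ f w @ t" "length s \<le> L" "length t \<le> L"
      have "length u = n" using u by (rule factors_length)
      then obtain v where v: "v \<in> T" "binomial_agree (Suc k) (f w) v"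
        using T(3)[OF w(1)] w by auto
      then have "binomial_equiv (k + 1) u (s @ v @ t)"
        using w by (simp add: binomial_equiv_iff_agree binomial_agree_append)
      moreover have "s @ v @ t \<in> ?F"
        using v w by (intro image_eqI[of _ _ "(s, v, t)"]) (auto simp: S_def)
      ultimately show ?thesis by blast
    qed
    ultimately show ?thesis
      using S T(1) by (intro exI[of _ "S \<union> ?F"]) auto
  qed
  then have "bounded_binomial_complexity (k + 1) y"
    unfolding bounded_binomial_complexity_iff_cover by blast
  then show "\<exists>y. infinite_image f x y \<and> bounded_binomial_complexity (k + 1) y"
    using y by blast
qed

subsection \<open>Iterated commutators\<close>

lemma binomial_agree_sym: "binomial_agree k u v \<Longrightarrow> binomial_agree k v u"
  by (simp add: binomial_agree_def)

text \<open>Top-degree differences are additive, so that of \<open>u\<close> against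
  \<open>v\<close> cancels that of \<open>v\<close> against \<open>u\<close>.\<close>

lemma binomial_agree_commute:
  assumes "binomial_agree k u v"
  shows "binomial_agree (Suc k) (u @ v) (v @ u)"
  unfolding binomial_agree_def
proof (intro allI impI)
  fix x :: "'a list" assume x: "length x \<le> Suc k"
  show "word_binomial (u @ v) x = word_binomial (v @ u) x"
  proof (cases "length x = Suc k")
    case True
    then show ?thesis
      using word_binomial_append_diff[OF assms binomial_agree_sym[OF assms] True] by simp
  next
    case False
    then have "length x \<le> k" using x by simp
    with binomial_agree_append[OF assms binomial_agree_sym[OF assms]] show ?thesis
      by (rule binomial_agreeD)
  qed
qed

text \<open>A split after \<open>d\<close> leaves a power of \<open>c\<close> to \<open>v\<close>.
  The split before the last \<open>c\<close> is set apart: it is the only proper one in which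
  \<open>u\<close> reads more than \<open>Suc k - 1\<close> letters, beyond the reach of agreement
  at level \<open>k\<close>.\<close>

lemma word_binomial_append_Cons_replicate:
  "word_binomial (u @ v) (d # replicate (Suc k) c) =
     word_binomial v (d # replicate (Suc k) c) + word_binomial u (d # replicate (Suc k) c) +
     word_binomial u (d # replicate k c) * count_list v c +
     (\<Sum>j<k. word_binomial u (d # replicate j c) * (count_list v c choose (Suc k - j)))"
proof -
  let ?x = "d # replicate (Suc k) c"
  let ?g = "\<lambda>j. word_binomial u (take j ?x) * word_binomial v (drop j ?x)"
  have "word_binomial (u @ v) ?x = (\<Sum>j\<le>length ?x. ?g j)"
    by (rule word_binomial_append)
  also have "\<dots> = (\<Sum>j<Suc (Suc (Suc k)). ?g j)"
    by (simp only: lessThan_Suc_atMost length_Cons length_replicate)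
  also have "\<dots> = ?g 0 + (\<Sum>j<Suc (Suc k). ?g (Suc j))"
    by (rule sum.lessThan_Suc_shift)
  also have "(\<Sum>j<Suc (Suc k). ?g (Suc j)) =
      (\<Sum>j<Suc (Suc k). word_binomial u (d # replicate j c) * (count_list v c choose (Suc k - j)))"
    by (rule sum.cong) (simp_all add: take_Cons' drop_Cons' word_binomial_replicate min_def
        del: replicate_Suc)
  finally show ?thesis
    by (simp add: algebra_simps)
qed

text \<open>In the expansion of the commutator of \<open>u\<close> and \<open>v\<close>, the coefficient of
  \<open>d c\<^sup>k\<^sup>+\<^sup>1\<close> is that of \<open>d c\<^sup>k\<close> in the difference
  times the number of letters \<open>c\<close>, since the powers of \<open>c\<close> do not distinguish \<open>u\<close> from \<open>v\<close>.\<close>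

lemma word_binomial_commutator_neq:
  assumes agree: "binomial_agree k u v" and "k > 0" and c: "count_list u c > 0"
    and neq: "word_binomial u (d # replicate k c) \<noteq> word_binomial v (d # replicate k c)"
  shows "word_binomial (u @ v) (d # replicate (Suc k) c) \<noteq>
    word_binomial (v @ u) (d # replicate (Suc k) c)"
proof -
  have count: "count_list u c = count_list v c"
    using binomial_agree_mset_eq[OF agree \<open>k > 0\<close>] by (metis count_mset)
  have "(\<Sum>j<k. word_binomial u (d # replicate j c) * (count_list v c choose (Suc k - j))) =
      (\<Sum>j<k. word_binomial v (d # replicate j c) * (count_list u c choose (Suc k - j)))"
    using agree by (intro sum.cong) (simp_all add: count binomial_agreeD)
  moreover have "word_binomial u (d # replicate k c) * count_list v c \<noteq>
      word_binomial v (d # replicate k c) * count_list u c"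
    using neq c by (simp add: count)
  ultimately show ?thesis
    unfolding word_binomial_append_Cons_replicate by linarith
qed

text \<open>In the base case the coefficients at \<open>[d, c]\<close> differ by the 2 by 2 minor of
  letter counts. Positivity of the count of \<open>c\<close> is carried along because each
  commutator multiplies the difference by it.\<close>

lemma iterated_commutator_neq:
  fixes U V :: "nat \<Rightarrow> 'a list"
  assumes U: "\<And>k. U (Suc k) = U k @ V k" and V: "\<And>k. V (Suc k) = V k @ U k"
    and cd: "count_list (U 0) c * count_list (V 0) d \<noteq> count_list (U 0) d * count_list (V 0) c"
  shows "binomial_agree (Suc k) (U (Suc k)) (V (Suc k)) \<and> count_list (U (Suc k)) c > 0 \<and>
    word_binomial (U (Suc k)) (d # replicate (Suc k) c) \<noteq>
    word_binomial (V (Suc k)) (d # replicate (Suc k) c)"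
proof (induction k)
  case 0
  have "count_list (U (Suc 0)) c > 0"
    using cd by (cases "count_list (U 0) c = 0") (auto simp: U)
  moreover have "word_binomial (U (Suc 0)) (d # replicate (Suc 0) c) \<noteq>
      word_binomial (V (Suc 0)) (d # replicate (Suc 0) c)"
    unfolding U V word_binomial_append_Cons_replicate using cd by (simp add: mult.commute)
  ultimately show ?case
    by (simp only: U V binomial_agree_commute binomial_agree_0 simp_thms)
next
  case (Suc k)
  then show ?case
    unfolding U[of "Suc k"] V[of "Suc k"]
    using binomial_agree_commute[of "Suc k" "U (Suc k)" "V (Suc k)"]
      word_binomial_commutator_neq[of "Suc k" "U (Suc k)" "V (Suc k)" c d]
    by (simp del: replicate_Suc)
qed

section \<open>Powers of words and unbounded complexity\<close>

abbreviation word_power :: "'a list \<Rightarrow> nat \<Rightarrow> 'a list" where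
  "word_power u n \<equiv> concat (replicate n u)"

lemma word_power_mult: "word_power u (i * p) = word_power (word_power u p) i"
  by (induction i) (simp_all add: replicate_add)

lemma length_word_power [simp]: "length (word_power u n) = n * length u"
  by (induction n) simp_all

lemma count_list_word_power [simp]: "count_list (word_power u n) c = n * count_list u c"
  by (induction n) simp_all

lemma word_power_agree:
  assumes "binomial_agree k u v"
  shows "binomial_agree k (word_power u i @ word_power v j) (word_power v (i + j))"
  by (induction i) (auto intro!: binomial_agree_append assms)

text \<open>Each \<open>v\<close> replaced by a \<open>u\<close> contributes the same top-degree
  difference.\<close>

lemma word_power_diff:
  assumes "binomial_agree k u v" "length x = Suc k"
  shows "int (word_binomial (word_power u i @ word_power v j) x) -
      int (word_binomial (word_power v (i + j)) x) =
    int i * (int (word_binomial u x) - int (word_binomial v x))"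
proof (induction i)
  case (Suc i)
  then show ?case
    using word_binomial_append_diff[OF assms(1) word_power_agree[OF assms(1), of i j] assms(2)]
    by (simp add: algebra_simps)
qed simp

text \<open>For \<open>i\<close> from 0 to \<open>C\<close> the words
  \<open>word_power u i @ word_power v (C - i)\<close> have distinct coefficients at
  \<open>x\<close>, so \<open>C\<close> classes do not suffice.\<close>

lemma unbounded_of_power_factors:
  fixes y :: "('a::finite) word"
  assumes agree: "binomial_agree k u v" and x: "length x = Suc k"
    and neq: "word_binomial u x \<noteq> word_binomial v x"
    and fac: "\<And>i j. word_power u i @ word_power v j \<in> factors ((i + j) * length u) y"
  shows "\<not> bounded_binomial_complexity (Suc k) y"
proof
  assume "bounded_binomial_complexity (Suc k) y"
  then obtain C where C: "\<And>n. \<exists>T. finite T \<and> card T \<le> C \<and>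
      (\<forall>w\<in>factors n y. \<exists>t\<in>T. binomial_equiv (Suc k) w t)"
    unfolding bounded_binomial_complexity_iff_cover by blast
  obtain T where T: "finite T" "card T \<le> C"
    "\<And>w. w \<in> factors (C * length u) y \<Longrightarrow> \<exists>t\<in>T. binomial_equiv (Suc k) w t"
    using C[of "C * length u"] by blast
  define w where "w i = word_power u i @ word_power v (C - i)" for i
  have "\<exists>t\<in>T. binomial_equiv (Suc k) (w i) t" if "i \<le> C" for i
    using that fac[of i "C - i"] by (intro T) (simp add: w_def)
  then obtain t where t: "\<And>i. i \<le> C \<Longrightarrow> t i \<in> T"
    "\<And>i. i \<le> C \<Longrightarrow> binomial_equiv (Suc k) (w i) (t i)" by metis
  have "inj_on t {..C}"
  proof (rule inj_onI)
    fix i j assume ij: "i \<in> {..C}" "j \<in> {..C}" and "t i = t j"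
    have "word_binomial (w i) x = word_binomial (t i) x" "word_binomial (w j) x = word_binomial (t j) x"
      using t(2)[of i] t(2)[of j] ij x by (auto simp: binomial_equiv_iff_agree binomial_agreeD)
    then have "word_binomial (w i) x = word_binomial (w j) x" using \<open>t i = t j\<close> by simp
    then have "int i * (int (word_binomial u x) - int (word_binomial v x)) =
        int j * (int (word_binomial u x) - int (word_binomial v x))"
      using word_power_diff[OF agree x, of i "C - i"] word_power_diff[OF agree x, of j "C - j"] ij
      by (simp add: w_def)
    then show "i = j" using neq by simp
  qed
  moreover have "t ` {..C} \<subseteq> T" using t(1) by auto
  ultimately have "card {..C} \<le> card T" using T(1) by (rule card_inj_on_le)
  then show False using T(2) by simp
qed

lemma morphism_replicate:
  assumes "word_morphism f"
  shows "f (replicate n a) = word_power (f [a]) n"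
proof (induction n)
  case (Suc n)
  then show ?case
    using word_morphism_append[OF assms, of "[a]" "replicate n a"] by simp
qed (simp add: word_morphism_Nil[OF assms])

lemma infinite_image_factor:
  assumes f: "word_morphism f" "infinite_image f x y" and w: "w \<in> factors m x"
  shows "f w \<in> factors (length (f w)) y"
proof -
  obtain i where i: "w = x [i \<rightarrow> i + m]" using w by (auto simp: factors_def)
  let ?p = "length (f (prefix i x))" and ?q = "length (f (prefix (i + m) x))"
  have fw: "f w = y [?p \<rightarrow> ?q]"
    using infinite_image_subsequence[OF f, of i "i + m"] i by simp
  have "?q = ?p + length (f w)"
    by (simp add: i subsequence_join flip: word_morphism_append[OF f(1)] length_append)
  with fw have "f w = y [?p \<rightarrow> ?p + length (f w)]" by argo
  then show ?thesis unfolding factors_def by blast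
qed

lemma word_with_blocks:
  "\<exists>z :: 'a word. \<forall>i j. replicate i a @ replicate j b \<in> factors (i + j) z"
proof -
  \<comment> \<open>The letter alternates at each perfect square, so the blocks grow without
    bound.\<close>
  define z where "z n = (if even (floor_sqrt n) then a else b)" for n
  have "replicate i a @ replicate j b \<in> factors (i + j) z" for i j
  proof -
    \<comment> \<open>An odd number: a block of \<open>a\<close> ends just before its square and a
      block of \<open>b\<close> starts there. Its size makes both blocks long enough.\<close>
    define t where "t = 2 * (i + j) + 1"
    have tt: "t\<^sup>2 = (t - 1)\<^sup>2 + 2 * (t - 1) + 1"
      by (simp add: t_def power2_eq_square algebra_simps)
    have "i \<le> t\<^sup>2" using tt by (simp add: t_def)
    have "z n = a" if "t\<^sup>2 - i \<le> n" "n < t\<^sup>2" for n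
    proof -
      have "floor_sqrt n = t - 1"
        using that tt by (intro floor_sqrt_unique) (auto simp: t_def)
      then show ?thesis by (simp add: z_def t_def)
    qed
    moreover have "z n = b" if "t\<^sup>2 \<le> n" "n < t\<^sup>2 + j" for n
    proof -
      have "floor_sqrt n = t"
        using that by (intro floor_sqrt_unique) (auto simp: t_def power2_eq_square algebra_simps)
      then show ?thesis by (simp add: z_def t_def)
    qed
    ultimately have "z [t\<^sup>2 - i \<rightarrow> t\<^sup>2] = replicate i a" "z [t\<^sup>2 \<rightarrow> t\<^sup>2 + j] = replicate j b"
      using \<open>i \<le> t\<^sup>2\<close> by (auto simp: subsequence_def intro!: replicate_eqI)
    then have "replicate i a @ replicate j b = z [t\<^sup>2 - i \<rightarrow> (t\<^sup>2 - i) + (i + j)]"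
      using \<open>i \<le> t\<^sup>2\<close> subsequence_join[of "t\<^sup>2 - i" "t\<^sup>2" "t\<^sup>2 + j" z] by simp
    then show ?thesis unfolding factors_def by blast
  qed
  then show ?thesis by blast
qed

text \<open>Letters other than \<open>b\<close> are all treated like \<open>a\<close>, so over the
  whole alphabet the letter images share one Parikh vector.\<close>

definition thue_morse :: "'a \<Rightarrow> 'a \<Rightarrow> 'a list \<Rightarrow> 'a list" where
  "thue_morse a b w = concat (map (\<lambda>l. if l = b then [b, a] else [a, b]) w)"

lemma thue_morse_morphism: "word_morphism (thue_morse a b)"
  by (simp add: word_morphism_def thue_morse_def)

lemma thue_morse_satisfies_P: "satisfies_P k (thue_morse (a::'a::finite) b)"
proof (rule parikh_collinear_imp_satisfies_P[OF thue_morse_morphism])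
  show "parikh_collinear (thue_morse a b)"
    unfolding parikh_collinear_def parikh_def
    by (intro allI exI[of _ 1]) (simp add: thue_morse_def)
qed (simp add: thue_morse_def)

lemma bounded_binomial_complexity_0: "bounded_binomial_complexity 0 x"
  unfolding bounded_binomial_complexity_iff_cover
  by (intro exI[of _ 1] allI, rule_tac x = "{prefix n x}" in exI)
    (auto simp: binomial_equiv_def factors_def)

text \<open>Level 0 is bounded for every word, and each application of \<open>g\<close> gains one
  level.\<close>

lemma bounded_binomial_complexity_iterated_image:
  fixes g :: "('a::finite) list \<Rightarrow> 'a list"
  assumes g: "word_morphism g" and P: "\<And>k. satisfies_P k g"
  shows "\<exists>x. bounded_binomial_complexity k x \<and>
    (\<forall>m. \<forall>w\<in>factors m z. (g ^^ k) w \<in> factors (length ((g ^^ k) w)) x)"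
proof (induction k)
  case 0
  show ?case
    by (rule exI[of _ z]) (auto simp: bounded_binomial_complexity_0 dest: factors_length)
next
  case (Suc k)
  then obtain x where x: "bounded_binomial_complexity k x"
    "\<And>m w. w \<in> factors m z \<Longrightarrow> (g ^^ k) w \<in> factors (length ((g ^^ k) w)) x" by blast
  obtain y where y: "infinite_image g x y" "bounded_binomial_complexity (k + 1) y"
    using P x(1) unfolding satisfies_P_def by blast
  have "(g ^^ Suc k) w \<in> factors (length ((g ^^ Suc k) w)) y" if "w \<in> factors m z" for m w
    using infinite_image_factor[OF g y(1) x(2)[OF that]] by simp
  then show ?case using y(2) by auto
qed

section \<open>Necessity of Parikh-collinearity\<close>

lemma word_morphism_compose: "word_morphism f \<Longrightarrow> word_morphism g \<Longrightarrow> word_morphism (\<lambda>w. f (g w))"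
  by (simp add: word_morphism_def)

lemma word_morphism_funpow:
  fixes g :: "'a list \<Rightarrow> 'a list"
  shows "word_morphism g \<Longrightarrow> word_morphism (g ^^ k)"
  by (induction k) (simp_all add: word_morphism_def)

text \<open>The constant word on \<open>a\<close> has bounded complexity at every level, but erasing
  \<open>a\<close> would leave it without an infinite image.\<close>

lemma satisfies_P_nonerasing:
  fixes f :: "('a::finite) list \<Rightarrow> ('b::finite) list"
  assumes f: "word_morphism f" and P: "satisfies_P k f"
  shows "f [a] \<noteq> []"
proof
  assume erased: "f [a] = []"
  have const: "(\<lambda>_. a) [i \<rightarrow> j] = replicate (j - i) a" for i j
    by (simp add: subsequence_def map_replicate_const)
  have "bounded_binomial_complexity k (\<lambda>_. a)"
    unfolding bounded_binomial_complexity_iff_cover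
    by (intro exI[of _ 1] allI, rule_tac x = "{replicate n a}" in exI)
      (auto simp: binomial_equiv_def factors_def const)
  then obtain y where "infinite_image f (\<lambda>_. a) y"
    using P unfolding satisfies_P_def by blast
  then obtain n where "1 \<le> length (f (prefix n (\<lambda>_. a)))"
    unfolding infinite_image_def by blast
  then show False
    by (simp add: const morphism_replicate[OF f] erased)
qed

lemma satisfies_P_imp_parikh_collinear:
  fixes f :: "('a::finite) list \<Rightarrow> ('b::finite) list"
  assumes f: "word_morphism f" and P: "satisfies_P k f"
  shows "parikh_collinear f"
proof (rule ccontr)
  assume "\<not> parikh_collinear f"
  then obtain a b where ab: "\<And>r::rat. \<exists>c. of_nat (count_list (f [b]) c) \<noteq> r * of_nat (count_list (f [a]) c)"
    unfolding parikh_collinear_def parikh_def by blast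
  have ne: "f [l] \<noteq> []" for l
    by (rule satisfies_P_nonerasing[OF f P])
  have "a \<noteq> b" using ab[of 1] by auto
  obtain c where "c \<in> set (f [a])" using ne[of a] by (meson last_in_set)
  then have c: "count_list (f [a]) c \<noteq> 0" by (simp add: count_list_0_iff)
  \<comment> \<open>The only ratio possible at \<open>c\<close>; its failure at some
    \<open>d\<close> gives a nonzero 2 by 2 minor of the Parikh vectors.\<close>
  define r :: rat where "r = of_nat (count_list (f [b]) c) / of_nat (count_list (f [a]) c)"
  obtain d where "of_nat (count_list (f [b]) d) \<noteq> r * of_nat (count_list (f [a]) d)"
    using ab[of r] by (elim exE)
  then have "(of_nat (count_list (f [a]) c * count_list (f [b]) d) :: rat) \<noteq>
      of_nat (count_list (f [a]) d * count_list (f [b]) c)"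
    using c by (simp add: r_def divide_simps mult.commute)
  then have cd: "count_list (f [a]) c * count_list (f [b]) d \<noteq> count_list (f [a]) d * count_list (f [b]) c"
    by fastforce
  let ?g = "thue_morse a b"
  define F where "F k w = f ((?g ^^ k) w)" for k w
  have F: "word_morphism (F k)" for k
    unfolding F_def by (rule word_morphism_compose[OF f word_morphism_funpow[OF thue_morse_morphism]])
  obtain z :: "'a word" where z: "\<And>i j. replicate i a @ replicate j b \<in> factors (i + j) z"
    using word_with_blocks[of a b] by blast
  obtain x where x: "bounded_binomial_complexity k x"
    "\<And>m w. w \<in> factors m z \<Longrightarrow> (?g ^^ k) w \<in> factors (length ((?g ^^ k) w)) x"
    using bounded_binomial_complexity_iterated_image[of ?g k z,
        OF thue_morse_morphism thue_morse_satisfies_P] by blast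
  obtain y where y: "infinite_image f x y" "bounded_binomial_complexity (k + 1) y"
    using P x(1) unfolding satisfies_P_def by blast
  have fac: "word_power (F k [a]) i @ word_power (F k [b]) j
      \<in> factors (i * length (F k [a]) + j * length (F k [b])) y" for i j
  proof -
    have "F k (replicate i a @ replicate j b) \<in> factors (length (F k (replicate i a @ replicate j b))) y"
      unfolding F_def by (rule infinite_image_factor[OF f y(1) x(2)[OF z]])
    then show ?thesis
      by (simp add: word_morphism_append[OF F] morphism_replicate[OF F])
  qed
  show False
  proof (cases k)
    case 0
    have F0: "F k w = f w" for w by (simp add: F_def 0)
    \<comment> \<open>Each exponent is the length of the other image, which equalises the lengths of
      the powers.\<close>
    define p q where "p = length (f [b])" and "q = length (f [a])"
    have "p > 0" "q > 0" using ne by (simp_all add: p_def q_def)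
    let ?u = "word_power (f [a]) p" and ?v = "word_power (f [b]) q"
    have "\<exists>e. count_list ?u e \<noteq> count_list ?v e"
    proof (rule ccontr)
      assume "\<not> ?thesis"
      then have e: "p * count_list (f [a]) e = q * count_list (f [b]) e" for e by simp
      have "(p * q) * (count_list (f [a]) c * count_list (f [b]) d) =
          (p * count_list (f [a]) c) * (q * count_list (f [b]) d)" by simp
      also have "\<dots> = (q * count_list (f [b]) c) * (p * count_list (f [a]) d)" by (simp add: e)
      also have "\<dots> = (p * q) * (count_list (f [a]) d * count_list (f [b]) c)" by simp
      finally show False using cd \<open>p > 0\<close> \<open>q > 0\<close> by simp
    qed
    then obtain e where "word_binomial ?u [e] \<noteq> word_binomial ?v [e]" by auto
    moreover have "word_power ?u i @ word_power ?v j \<in> factors ((i + j) * length ?u) y" for i j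
      using fac[of "i * p" "j * q"]
      by (simp add: F0 word_power_mult p_def q_def algebra_simps)
    ultimately have "\<not> bounded_binomial_complexity (Suc 0) y"
      by (intro unbounded_of_power_factors[of 0 ?u ?v "[e]"]) auto
    then show False using y(2) 0 by simp
  next
    case (Suc l)
    have "?g [a] = [a] @ [b]" "?g [b] = [b] @ [a]"
      using \<open>a \<noteq> b\<close> by (simp_all add: thue_morse_def)
    \<comment> \<open>Unfolding the innermost application of the morphism gives the commutator
      recursion.\<close>
    then have rec: "F (Suc n) [a] = F n [a] @ F n [b]" "F (Suc n) [b] = F n [b] @ F n [a]" for n
      using word_morphism_append[OF F, of n]
      by (simp_all add: F_def funpow_Suc_right del: funpow.simps append.simps)
    have "count_list (F 0 [a]) c * count_list (F 0 [b]) d \<noteq> count_list (F 0 [a]) d * count_list (F 0 [b]) c"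
      using cd by (simp add: F_def)
    from iterated_commutator_neq[of "\<lambda>n. F n [a]" "\<lambda>n. F n [b]", OF rec this, of l]
    have "binomial_agree k (F k [a]) (F k [b])"
      "word_binomial (F k [a]) (d # replicate k c) \<noteq> word_binomial (F k [b]) (d # replicate k c)"
      by (simp_all add: Suc)
    moreover have "length (F k [a]) = length (F k [b])"
      by (simp add: Suc rec)
    ultimately have "\<not> bounded_binomial_complexity (Suc k) y"
      using fac by (intro unbounded_of_power_factors[of k "F k [a]" "F k [b]" "d # replicate k c"])
        (auto simp: algebra_simps)
    then show False using y(2) by simp
  qed
qed

theorem theorem3p5:
  fixes f :: "('a::finite) list \<Rightarrow> ('b::finite) list"
  assumes morphism: "word_morphism f"
    and not_totally_erasing: "\<exists>a. f [a] \<noteq> []"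
  shows "(parikh_collinear f \<longleftrightarrow> (\<forall>k. satisfies_P k f)) \<and>
         ((\<forall>k. satisfies_P k f) \<longleftrightarrow> (\<exists>k. satisfies_P k f))"
proof -
  have "satisfies_P k f" if col: "parikh_collinear f" for k
  proof (rule parikh_collinear_imp_satisfies_P[OF morphism col])
    fix a
    \<comment> \<open>A nonempty letter image is a multiple of every other one by collinearity, so
      none is empty. Erasing all letters would be collinear, yet without infinite images.\<close>
    obtain a0 where "f [a0] \<noteq> []" using not_totally_erasing by blast
    then obtain c where "c \<in> set (f [a0])" by (meson last_in_set)
    then have c: "count_list (f [a0]) c \<noteq> 0" by (simp add: count_list_0_iff)
    obtain r :: rat where "of_nat (count_list (f [a0]) c) = r * of_nat (count_list (f [a]) c)"
      using col unfolding parikh_collinear_def parikh_def by blast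
    then show "f [a] \<noteq> []" using c by auto
  qed
  then show ?thesis
    using satisfies_P_imp_parikh_collinear[OF morphism] by blast
qed

end
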